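(* Let $\mu\in\mathcal{M}$. The map $\mathcal{G}\mapsto\mathcal{G}_\mu$, defined on $\mathbb{G}$, is increasing, i.e., if $\mathcal{G},\mathcal{H}\in\mathbb{G}$ and $\mathcal{G}\subseteq\mathcal{H}$ then $\mathcal{G}_\mu\subseteq\mathcal{H}_\mu$ $\mu$-a.e., and it satisfies the following property: if $\{\mathcal{G}^i\}_{i\in I}\subseteq\mathbb{G}$ (with $I\ne\emptyset$), then there exists a non-empty countable $J\subseteq I$ such that $$\Big(\bigvee_{i\in I}\mathcal{G}^i\Big)_\mu=\Big(\bigvee_{i\in J}\mathcal{G}^i\Big)_\mu.$$ Moreover, $\big(\bigvee_{i\in J}\mathcal{G}^i\big)_\mu=\bigcup_{i\in J}\mathcal{G}^i_\mu$ holds for any non-empty countable $J\subseteq I$. (Equalities are up to $\mu$-null sets.)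
   Context: $(\Omega,\mathcal{F})$ is a measurable space and $\mathcal{M}$ is the space of real-valued (finite signed, countably additive) measures on it. A set $F\in\mathcal{F}$ is $\mu$-null if $\mu(H)=0$ for all $H\in\mathcal{F}$, $H\subseteq F$ (equivalently $|\mu|(F)=0$); $F\subseteq F'$ $\mu$-a.e. means that $F\setminus F'$ is $\mu$-null. $\mathbb{G}$ is the set of all non-empty families $\mathcal{G}\subseteq\mathcal{F}$ which are closed under countable unions, ordered by inclusion. The supremum in $\mathbb{G}$ of a non-empty collection $\{\mathcal{G}^i\}_{i\in I}\subseteq\mathbb{G}$ is denoted $\bigvee_{i\in I}\mathcal{G}^i$; it is the smallest family in $\mathbb{G}$ containing $\bigcup_{i\in I}\mathcal{G}^i$. For $\mathcal{G}\in\mathbb{G}$, $\mathcal{G}_\mu$ (the $\mathcal{G}$-atomic support of $\mu$) denotes the equivalence class, up to $\mu$-null sets, of a set $G_\mu\in\mathcal{G}$ such that $G\setminus G_\mu$ is $\mu$-null for every $G\in\mathcal{G}$; such a set exists and is unique up to $\mu$-null sets, and the class is identified with its representatives. *)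

theory Defs
  imports "HOL-Analysis.Analysis"
begin

text \<open>The library's \<open>countably_additive\<close> is only for \<open>ennreal\<close>-valued set functions.
  The values of \<open>\<mu>\<close> outside the sigma-algebra \<open>F\<close> are irrelevant.\<close>

definition signed_measure :: "'a set set \<Rightarrow> ('a set \<Rightarrow> real) \<Rightarrow> bool" where
  "signed_measure F \<mu> \<longleftrightarrow> \<mu> {} = 0 \<and>
     (\<forall>A :: nat \<Rightarrow> 'a set. range A \<subseteq> F \<longrightarrow> disjoint_family A \<longrightarrow>
        (\<lambda>i. \<mu> (A i)) sums \<mu> (\<Union>i. A i))"

definition signed_null :: "'a set set \<Rightarrow> ('a set \<Rightarrow> real) \<Rightarrow> 'a set \<Rightarrow> bool" where
  "signed_null F \<mu> N \<longleftrightarrow> N \<in> F \<and> (\<forall>H\<in>F. H \<subseteq> N \<longrightarrow> \<mu> H = 0)"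

definition ae_subset :: "'a set set \<Rightarrow> ('a set \<Rightarrow> real) \<Rightarrow> 'a set \<Rightarrow> 'a set \<Rightarrow> bool" where
  "ae_subset F \<mu> A B \<longleftrightarrow> signed_null F \<mu> (A - B)"

definition ae_eq_rel :: "'a set set \<Rightarrow> ('a set \<Rightarrow> real) \<Rightarrow> 'a set rel" where
  "ae_eq_rel F \<mu> = {(A, B). A \<in> F \<and> B \<in> F \<and> ae_subset F \<mu> A B \<and> ae_subset F \<mu> B A}"

text \<open>Countable unions are unions of sequences, hence of non-empty countable subfamilies: a member
  of \<open>cu_families F\<close> need not contain the empty set.\<close>

definition cu_families :: "'a set set \<Rightarrow> 'a set set set" where
  "cu_families F = {\<G>. \<G> \<noteq> {} \<and> \<G> \<subseteq> F \<and>
     (\<forall>A :: nat \<Rightarrow> 'a set. range A \<subseteq> \<G> \<longrightarrow> (\<Union>i. A i) \<in> \<G>)}"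

definition cu_Sup :: "'a set set \<Rightarrow> 'a set set set \<Rightarrow> 'a set set" where
  "cu_Sup F \<C> = \<Inter>{\<H> \<in> cu_families F. \<Union>\<C> \<subseteq> \<H>}"

text \<open>The whole equivalence class in \<open>F\<close> (not only its members lying in \<open>\<G>\<close>) of a set \<open>S \<in> \<G>\<close>
  that contains every member of \<open>\<G>\<close> almost everywhere. It would be empty if no such \<open>S\<close> existed.\<close>

definition atomic_support :: "'a set set \<Rightarrow> ('a set \<Rightarrow> real) \<Rightarrow> 'a set set \<Rightarrow> 'a set set" where
  "atomic_support F \<mu> \<G> = ae_eq_rel F \<mu> `` {S \<in> \<G>. \<forall>G\<in>\<G>. signed_null F \<mu> (G - S)}"

text \<open>Inclusion and union of equivalence classes, through representatives. Since the choice of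
  representatives does not matter (see \<open>class_subset_iff\<close>), \<open>\<exists>\<close> is used for inclusion; in
  particular inclusion fails if one of the classes is empty.\<close>

definition class_subset ::
    "'a set set \<Rightarrow> ('a set \<Rightarrow> real) \<Rightarrow> 'a set set \<Rightarrow> 'a set set \<Rightarrow> bool" where
  "class_subset F \<mu> X Y \<longleftrightarrow> (\<exists>A\<in>X. \<exists>B\<in>Y. ae_subset F \<mu> A B)"

definition class_Union ::
    "'a set set \<Rightarrow> ('a set \<Rightarrow> real) \<Rightarrow> ('i \<Rightarrow> 'a set set) \<Rightarrow> 'i set \<Rightarrow> 'a set set" where
  "class_Union F \<mu> X J = ae_eq_rel F \<mu> `` {\<Union>i\<in>J. R i | R. \<forall>i\<in>J. R i \<in> X i}"


lemma cu_Sup_least: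
  assumes "sigma_algebra \<Omega> F" and "\<C> \<noteq> {}" and "\<C> \<subseteq> cu_families F"
  shows "cu_Sup F \<C> \<in> cu_families F"
    and "\<G> \<in> \<C> \<Longrightarrow> \<G> \<subseteq> cu_Sup F \<C>"
    and "\<H> \<in> cu_families F \<Longrightarrow> (\<And>\<G>. \<G> \<in> \<C> \<Longrightarrow> \<G> \<subseteq> \<H>) \<Longrightarrow> cu_Sup F \<C> \<subseteq> \<H>"
proof -
  interpret sigma_algebra \<Omega> F by fact
  obtain \<G>0 where g0: "\<G>0 \<in> \<C>" using assms(2) by auto
  then obtain A0 where a0: "A0 \<in> \<G>0" using assms(3) unfolding cu_families_def by blast
  have F: "F \<in> cu_families F" "\<Union>\<C> \<subseteq> F"
    using assms(3) by (auto simp: cu_families_def)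
  have ne: "A0 \<in> cu_Sup F \<C>" using g0 a0 by (auto simp: cu_Sup_def)
  have sub: "cu_Sup F \<C> \<subseteq> F" using F unfolding cu_Sup_def by blast
  have cl: "(\<Union>i. A i) \<in> cu_Sup F \<C>" if "range A \<subseteq> cu_Sup F \<C>" for A :: "nat \<Rightarrow> 'a set"
    unfolding cu_Sup_def
  proof (rule InterI)
    fix \<H> assume h: "\<H> \<in> {\<H> \<in> cu_families F. \<Union>\<C> \<subseteq> \<H>}"
    then have "range A \<subseteq> \<H>" using that unfolding cu_Sup_def by blast
    then show "(\<Union>i. A i) \<in> \<H>" using h by (auto simp: cu_families_def)
  qed
  show "cu_Sup F \<C> \<in> cu_families F"
    unfolding cu_families_def using ne sub cl by blast
  show "\<G> \<in> \<C> \<Longrightarrow> \<G> \<subseteq> cu_Sup F \<C>" by (auto simp: cu_Sup_def)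
  show "\<H> \<in> cu_families F \<Longrightarrow> (\<And>\<G>. \<G> \<in> \<C> \<Longrightarrow> \<G> \<subseteq> \<H>) \<Longrightarrow> cu_Sup F \<C> \<subseteq> \<H>"
    unfolding cu_Sup_def by blast
qed

lemma signed_null_subset:
  "signed_null F \<mu> N \<Longrightarrow> M \<in> F \<Longrightarrow> M \<subseteq> N \<Longrightarrow> signed_null F \<mu> M"
  by (auto simp: signed_null_def)

lemma signed_null_UN:
  fixes N :: "nat \<Rightarrow> 'a set"
  assumes "sigma_algebra \<Omega> F" and "signed_measure F \<mu>" and N: "\<And>i. signed_null F \<mu> (N i)"
  shows "signed_null F \<mu> (\<Union>i. N i)"
  unfolding signed_null_def
proof (intro conjI ballI impI)
  interpret sigma_algebra \<Omega> F by fact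
  have NF: "N i \<in> F" for i using N by (simp add: signed_null_def)
  then show "(\<Union>i. N i) \<in> F" by auto
  fix H assume H: "H \<in> F" "H \<subseteq> (\<Union>i. N i)"
  define D where "D i = H \<inter> disjointed N i" for i
  have DF: "D i \<in> F" for i
    using H NF range_disjointed_sets[of N] by (auto simp: D_def)
  have "D i \<subseteq> N i" for i using disjointed_subset[of N i] by (auto simp: D_def)
  then have "\<mu> (D i) = 0" for i using N[of i] DF[of i] by (auto simp: signed_null_def)
  moreover have "disjoint_family D"
    using disjoint_family_disjointed[of N] by (auto simp: D_def disjoint_family_on_def)
  moreover have "(\<Union>i. D i) = H"
  proof -
    have "(\<Union>i. D i) = H \<inter> (\<Union>i. disjointed N i)" by (auto simp: D_def)
    also have "\<dots> = H" using H by (auto simp: UN_disjointed_eq)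
    finally show ?thesis .
  qed
  ultimately have "(\<lambda>i. 0) sums \<mu> H"
    using assms(2) DF unfolding signed_measure_def
    by (metis (no_types, lifting) ext image_subset_iff)
  then show "\<mu> H = 0" using sums_unique2 sums_zero by blast
qed

lemma ae_subset_trans:
  assumes "sigma_algebra \<Omega> F" and "signed_measure F \<mu>"
    and "A \<in> F" "B \<in> F" "C \<in> F" "ae_subset F \<mu> A B" "ae_subset F \<mu> B C"
  shows "ae_subset F \<mu> A C"
proof -
  interpret sigma_algebra \<Omega> F by fact
  define N where "N i = (if i = 0 then A - B else B - C)" for i :: nat
  have "signed_null F \<mu> (N i)" for i using assms(6,7) by (simp add: N_def ae_subset_def)
  from signed_null_UN[OF assms(1,2) this] have "signed_null F \<mu> (\<Union>i. N i)" .
  moreover have "A - C \<subseteq> N 0 \<union> N 1" by (auto simp: N_def)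
  then have "A - C \<subseteq> (\<Union>i. N i)" by blast
  ultimately show ?thesis
    unfolding ae_subset_def using assms(3,5) signed_null_subset by blast
qed

lemma equiv_ae_eq_rel:
  assumes "sigma_algebra \<Omega> F" and "signed_measure F \<mu>"
  shows "equiv F (ae_eq_rel F \<mu>)"
proof (rule equivI)
  interpret sigma_algebra \<Omega> F by fact
  show "ae_eq_rel F \<mu> \<subseteq> F \<times> F" by (auto simp: ae_eq_rel_def)
  show "refl_on F (ae_eq_rel F \<mu>)"
    using assms(2) by (auto simp: refl_on_def ae_eq_rel_def ae_subset_def signed_null_def
        signed_measure_def)
  show "sym (ae_eq_rel F \<mu>)" by (auto simp: sym_def ae_eq_rel_def)
  show "trans (ae_eq_rel F \<mu>)"
    unfolding trans_def ae_eq_rel_def using ae_subset_trans[OF assms] by blast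
qed

lemma atomic_support_eq_class:
  assumes "sigma_algebra \<Omega> F" and "signed_measure F \<mu>" and "\<G> \<in> cu_families F"
    and S: "S \<in> \<G>" "\<And>G. G \<in> \<G> \<Longrightarrow> signed_null F \<mu> (G - S)"
  shows "atomic_support F \<mu> \<G> = ae_eq_rel F \<mu> `` {S}"
proof -
  have "(S, T) \<in> ae_eq_rel F \<mu>" if "T \<in> \<G>" "\<forall>G\<in>\<G>. signed_null F \<mu> (G - T)" for T
    using that S assms(3) by (auto simp: ae_eq_rel_def ae_subset_def cu_families_def)
  then show ?thesis
    using S equiv_class_eq[OF equiv_ae_eq_rel[OF assms(1,2)]]
    unfolding atomic_support_def by blast
qed

lemma class_subset_iff:
  assumes "sigma_algebra \<Omega> F" and "signed_measure F \<mu>"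
    and X: "X \<in> F // ae_eq_rel F \<mu>" and Y: "Y \<in> F // ae_eq_rel F \<mu>"
  shows "class_subset F \<mu> X Y \<longleftrightarrow> (\<forall>A\<in>X. \<forall>B\<in>Y. ae_subset F \<mu> A B)"
proof -
  note eq = equiv_ae_eq_rel[OF assms(1,2)]
  have ne: "X \<noteq> {}" "Y \<noteq> {}" using X Y in_quotient_imp_non_empty[OF eq] by auto
  have "ae_subset F \<mu> A' B'"
    if "A \<in> X" "B \<in> Y" "A' \<in> X" "B' \<in> Y" "ae_subset F \<mu> A B" for A B A' B'
  proof -
    have "(A', A) \<in> ae_eq_rel F \<mu>" "(B, B') \<in> ae_eq_rel F \<mu>"
      using that quotient_eq_iff[OF eq X X] quotient_eq_iff[OF eq Y Y] by blast+
    then have F: "A' \<in> F" "A \<in> F" "B \<in> F" "B' \<in> F"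
      and le: "ae_subset F \<mu> A' A" "ae_subset F \<mu> B B'"
      by (auto simp: ae_eq_rel_def)
    note tr = ae_subset_trans[OF assms(1,2)]
    show ?thesis
      by (rule tr[OF F(1) F(3) F(4) tr[OF F(1-3) le(1) that(5)] le(2)])
  qed
  moreover obtain A B where "A \<in> X" "B \<in> Y" using ne by auto
  ultimately show ?thesis unfolding class_subset_def by metis
qed

end

theory Submission
  imports Defs
begin

text \<open>Existence of \<open>\<G>\<^sub>\<mu>\<close> is an exhaustion argument that needs no total variation: if for some
  \<open>\<epsilon> > 0\<close> every \<open>S \<in> \<G>\<close> left out a set \<open>H \<subseteq> G - S\<close> with \<open>G \<in> \<G>\<close> and \<open>\<bar>\<mu> H\<bar> > \<epsilon>\<close>, adding the sets
  \<open>G\<close> one by one would produce a disjoint sequence of such \<open>H\<close>, along which \<open>\<mu>\<close> cannot be summable.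
  The union of sets \<open>S\<close> good for \<open>\<epsilon> = 1, 1/2, 1/3, \<dots>\<close> is then good for all \<open>\<epsilon>\<close>.
  A set in the supremum of \<open>(\<G>\<^sup>i)\<close> over \<open>i \<in> I\<close> is a countable union of members of the \<open>\<G>\<^sup>i\<close>, so
  a representative of the support of the supremum already lies in a countable subsupremum.\<close>

section \<open>Closure of families under countable unions\<close>

lemma cu_familiesI:
  assumes "\<G> \<noteq> {}" "\<G> \<subseteq> F" "\<And>A :: nat \<Rightarrow> 'a set. range A \<subseteq> \<G> \<Longrightarrow> (\<Union>i. A i) \<in> \<G>"
  shows "\<G> \<in> cu_families F"
  using assms by (simp add: cu_families_def)

lemma cu_families_UN:
  assumes "\<G> \<in> cu_families F" "countable J" "J \<noteq> {}" "\<And>i. i \<in> J \<Longrightarrow> A i \<in> \<G>"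
  shows "(\<Union>i\<in>J. A i) \<in> \<G>"
proof -
  \<comment> \<open>The sequence \<open>from_nat_into J\<close> covers \<open>J\<close>, with
    repetitions if \<open>J\<close> is finite. An empty \<open>J\<close> would give the empty set,
    which \<open>\<G>\<close> may omit.\<close>
  have "range (\<lambda>n. A (from_nat_into J n)) \<subseteq> \<G>"
    using assms(4)[OF from_nat_into[OF assms(3)]] by (rule image_subsetI)
  then have "(\<Union>n. A (from_nat_into J n)) \<in> \<G>"
    using assms(1) by (simp add: cu_families_def)
  moreover have "range (\<lambda>n. A (from_nat_into J n)) = A ` range (from_nat_into J)"
    by (simp only: image_image)
  ultimately show ?thesis
    by (simp only: range_from_nat_into[OF assms(3,2)])
qed

lemma cu_families_Un:
  assumes "\<G> \<in> cu_families F" "A \<in> \<G>" "B \<in> \<G>"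
  shows "A \<union> B \<in> \<G>"
  using cu_families_UN[OF assms(1), of "{A, B}" "\<lambda>x. x"] assms(2,3) by auto

section \<open>Existence of the atomic support by exhaustion\<close>

lemma exists_eps_exhausting:
  assumes "signed_measure F \<mu>" "\<G> \<in> cu_families F" "\<epsilon> > 0"
  shows "\<exists>S\<in>\<G>. \<forall>G\<in>\<G>. \<forall>H\<in>F. H \<subseteq> G - S \<longrightarrow> \<bar>\<mu> H\<bar> \<le> \<epsilon>"
proof (rule ccontr)
  assume "\<not> ?thesis"
  \<comment> \<open>The implication sits under the existentials so that the choice functions
    \<open>g\<close> and \<open>h\<close> are total.\<close>
  then have "\<forall>S. \<exists>G H. S \<in> \<G> \<longrightarrow> G \<in> \<G> \<and> H \<in> F \<and> H \<subseteq> G - S \<and> \<bar>\<mu> H\<bar> > \<epsilon>"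
    by (meson not_le)
  then obtain g h where gh:
    "\<And>S. S \<in> \<G> \<Longrightarrow> g S \<in> \<G> \<and> h S \<in> F \<and> h S \<subseteq> g S - S \<and> \<bar>\<mu> (h S)\<bar> > \<epsilon>"
    by metis
  obtain G0 where "G0 \<in> \<G>" using assms(2) by (auto simp: cu_families_def)
  \<comment> \<open>\<open>T\<close> absorbs at each stage the set \<open>g (T n)\<close> it fails
    to exhaust. Hence \<open>h (T n)\<close> lies outside \<open>T n\<close> but inside
    \<open>T (Suc n)\<close>, which makes these sets disjoint.\<close>
  define T where "T = rec_nat G0 (\<lambda>_ S. S \<union> g S)"
  have T_Suc: "T (Suc n) = T n \<union> g (T n)" for n
    by (simp add: T_def)
  have TG: "T n \<in> \<G>" for n
  proof (induction n)
    case 0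
    show ?case using \<open>G0 \<in> \<G>\<close> by (simp add: T_def)
  next
    case (Suc n)
    then show ?case using cu_families_Un[OF assms(2)] gh by (simp add: T_Suc)
  qed
  have mono: "m \<le> n \<Longrightarrow> T m \<subseteq> T n" for m n
    by (rule lift_Suc_mono_le[of T]) (auto simp: T_Suc)
  have hT: "h (T m) \<inter> h (T n) = {}" if "m < n" for m n
  proof -
    have "h (T m) \<subseteq> T (Suc m)" using gh[OF TG[of m]] by (auto simp: T_Suc)
    moreover have "T (Suc m) \<subseteq> T n" using mono that by simp
    ultimately show ?thesis using gh[OF TG[of n]] by blast
  qed
  have "disjoint_family (\<lambda>n. h (T n))"
    unfolding disjoint_family_on_def using hT by (metis Int_commute linorder_neqE_nat)
  moreover have "range (\<lambda>n. h (T n)) \<subseteq> F" using gh[OF TG] by auto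
  ultimately have "(\<lambda>n. \<mu> (h (T n))) sums \<mu> (\<Union>n. h (T n))"
    using assms(1) unfolding signed_measure_def by blast
  \<comment> \<open>Terms of a convergent series tend to 0, whereas each of these exceeds
    \<open>\<epsilon>\<close> in absolute value.\<close>
  then have "(\<lambda>n. \<mu> (h (T n))) \<longlonglongrightarrow> 0"
    by (intro summable_LIMSEQ_zero sums_summable)
  then obtain n where "\<bar>\<mu> (h (T n))\<bar> < \<epsilon>"
    using LIMSEQ_D[OF _ assms(3)] by fastforce
  then show False using gh[OF TG[of n]] by simp
qed

lemma atomic_support_representative:
  assumes "sigma_algebra \<Omega> F" "signed_measure F \<mu>" "\<G> \<in> cu_families F"
  obtains S where "S \<in> \<G>" "\<And>G. G \<in> \<G> \<Longrightarrow> signed_null F \<mu> (G - S)"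
proof -
  interpret sigma_algebra \<Omega> F by fact
  have "\<exists>S\<in>\<G>. \<forall>G\<in>\<G>. \<forall>H\<in>F. H \<subseteq> G - S \<longrightarrow> \<bar>\<mu> H\<bar> \<le> 1 / Suc n" for n
    by (rule exists_eps_exhausting[OF assms(2,3)]) simp
  then obtain S where S: "\<And>n. S n \<in> \<G>"
      "\<And>n G H. G \<in> \<G> \<Longrightarrow> H \<in> F \<Longrightarrow> H \<subseteq> G - S n \<Longrightarrow> \<bar>\<mu> H\<bar> \<le> 1 / Suc n"
    by metis
  show thesis
  proof
    show SG: "(\<Union>n. S n) \<in> \<G>"
      using assms(3) S(1) by (auto simp: cu_families_def)
    fix G assume G: "G \<in> \<G>"
    show "signed_null F \<mu> (G - (\<Union>n. S n))"
      unfolding signed_null_def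
    proof (intro conjI ballI impI)
      show "G - (\<Union>n. S n) \<in> F" using G SG assms(3) by (auto simp: cu_families_def)
      fix H assume "H \<in> F" "H \<subseteq> G - (\<Union>n. S n)"
      \<comment> \<open>\<open>H\<close> avoids the union, hence every single \<open>S n\<close>, so
        all the bounds apply to it at once.\<close>
      then have "\<bar>\<mu> H\<bar> \<le> 1 / Suc n" for n by (intro S(2)[OF G]) auto
      then have "\<not> \<bar>\<mu> H\<bar> > 0"
        using nat_approx_posE[of "\<bar>\<mu> H\<bar>"] by (meson not_le)
      then show "\<mu> H = 0" by simp
    qed
  qed
qed

section \<open>Almost-everywhere domination and suprema of families\<close>

text \<open>Countably many null differences have a null union. With this, domination by
  \<open>S\<close> passes from the members of the given families to every member of their supremum,
  because the supremum is the least family containing them.\<close>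

lemma dominated_cu_families:
  assumes "sigma_algebra \<Omega> F" "signed_measure F \<mu>" "S \<in> F"
  shows "{A \<in> F. ae_subset F \<mu> A S} \<in> cu_families F"
proof -
  interpret sigma_algebra \<Omega> F by fact
  have "S \<in> {A \<in> F. ae_subset F \<mu> A S}"
    using assms(2,3) by (simp add: ae_subset_def signed_null_def signed_measure_def)
  moreover have "(\<Union>i. A i) \<in> {A \<in> F. ae_subset F \<mu> A S}"
    if "range A \<subseteq> {A \<in> F. ae_subset F \<mu> A S}" for A :: "nat \<Rightarrow> 'a set"
  proof -
    have "signed_null F \<mu> (A i - S)" for i using that by (auto simp: ae_subset_def)
    from signed_null_UN[OF assms(1,2) this]
    have "signed_null F \<mu> ((\<Union>i. A i) - S)" by simp
    moreover have "(\<Union>i. A i) \<in> F" using that by auto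
    ultimately show ?thesis by (simp add: ae_subset_def)
  qed
  ultimately show ?thesis by (intro cu_familiesI) auto
qed

lemma ae_subset_UN:
  assumes "sigma_algebra \<Omega> F" "signed_measure F \<mu>" "countable J" "J \<noteq> {}"
    and "\<And>i. i \<in> J \<Longrightarrow> A i \<in> F" "S \<in> F" "\<And>i. i \<in> J \<Longrightarrow> ae_subset F \<mu> (A i) S"
  shows "ae_subset F \<mu> (\<Union>i\<in>J. A i) S"
  using cu_families_UN[OF dominated_cu_families[OF assms(1,2,6)] assms(3,4), of A] assms(5,7)
  by blast

lemma ae_subset_mono:
  assumes "sigma_algebra \<Omega> F" "A \<in> F" "C \<in> F" "ae_subset F \<mu> A B" "B \<subseteq> C"
  shows "ae_subset F \<mu> A C"
proof -
  interpret sigma_algebra \<Omega> F by fact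
  show ?thesis
    using assms(2-) signed_null_subset[of F \<mu> "A - B" "A - C"] by (auto simp: ae_subset_def)
qed

text \<open>The countable unions of members of \<open>\<Union>\<C>\<close> already form a family
  closed under countable unions and containing \<open>\<Union>\<C>\<close>, so the least such family
  is contained in it.\<close>

lemma cu_Sup_countable_union:
  assumes "sigma_algebra \<Omega> F" "\<C> \<noteq> {}" "\<C> \<subseteq> cu_families F" "S \<in> cu_Sup F \<C>"
  obtains A :: "nat \<Rightarrow> 'a set" where "range A \<subseteq> \<Union>\<C>" "S = (\<Union>n. A n)"
proof -
  interpret sigma_algebra \<Omega> F by fact
  let ?U = "{\<Union>n. A n | A :: nat \<Rightarrow> 'a set. range A \<subseteq> \<Union>\<C>}"
  have sub: "\<Union>\<C> \<subseteq> ?U"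
  proof
    fix A assume "A \<in> \<Union>\<C>"
    then show "A \<in> ?U" by (intro CollectI exI[of _ "\<lambda>_::nat. A"]) auto
  qed
  have "\<Union>\<C> \<noteq> {}" "\<Union>\<C> \<subseteq> F" using assms(2,3) by (fastforce simp: cu_families_def)+
  then have "?U \<noteq> {}" using sub by (metis subset_empty)
  moreover have "?U \<subseteq> F"
  proof clarify
    fix A :: "nat \<Rightarrow> 'a set" assume "range A \<subseteq> \<Union>\<C>"
    then have "range A \<subseteq> F" using \<open>\<Union>\<C> \<subseteq> F\<close> by (rule subset_trans)
    then show "(\<Union>n. A n) \<in> F" by (rule countable_nat_UN)
  qed
  moreover have "(\<Union>n. B n) \<in> ?U" if B: "range B \<subseteq> ?U" for B :: "nat \<Rightarrow> 'a set"
  proof -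
    have "\<exists>A :: nat \<Rightarrow> 'a set. range A \<subseteq> \<Union>\<C> \<and> B n = (\<Union>m. A m)" for n
    proof -
      have "B n \<in> ?U" using B by (rule subsetD) simp
      then show ?thesis by (simp add: conj_commute)
    qed
    then obtain A :: "nat \<Rightarrow> nat \<Rightarrow> 'a set"
      where A: "\<And>n. range (A n) \<subseteq> \<Union>\<C>" "\<And>n. B n = (\<Union>m. A n m)" by metis
    \<comment> \<open>The pairing bijection flattens the double sequence into a single one.\<close>
    let ?A = "\<lambda>k. case_prod A (prod_decode k)"
    have "(\<Union>k. ?A k) = \<Union>(case_prod A ` range prod_decode)"
      by (simp only: image_image)
    also have "\<dots> = (\<Union>n. B n)" by (auto simp: A(2) surj_prod_decode)
    finally have "(\<Union>n. B n) = (\<Union>k. ?A k)" ..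
    moreover have "range ?A \<subseteq> \<Union>\<C>"
    proof (rule image_subsetI)
      fix k show "?A k \<in> \<Union>\<C>"
        using subsetD[OF A(1) rangeI] by (simp add: case_prod_beta)
    qed
    ultimately show ?thesis by (intro CollectI exI[of _ ?A] conjI)
  qed
  ultimately have "?U \<in> cu_families F"
    by (rule cu_familiesI)
  with sub have "cu_Sup F \<C> \<subseteq> ?U"
    unfolding cu_Sup_def by (intro Inter_lower CollectI conjI)
  then have "S \<in> ?U" using assms(4) by (rule subsetD)
  then show thesis using that by (elim CollectE exE conjE)
qed

section \<open>Monotonicity, reduction to countable suprema, and the union formula\<close>

text \<open>A representative chosen inside \<open>\<G>\<close> is a member of \<open>\<H>\<close>,
  so the representative for \<open>\<H>\<close> dominates it.\<close>

lemma atomic_support_mono: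
  assumes "sigma_algebra \<Omega> F" "signed_measure F \<mu>"
    and "\<G> \<in> cu_families F" "\<H> \<in> cu_families F" "\<G> \<subseteq> \<H>"
  shows "class_subset F \<mu> (atomic_support F \<mu> \<G>) (atomic_support F \<mu> \<H>)"
proof -
  obtain S where S: "S \<in> \<G>" "\<And>G. G \<in> \<G> \<Longrightarrow> signed_null F \<mu> (G - S)"
    using atomic_support_representative[OF assms(1-3)] by blast
  obtain T where T: "T \<in> \<H>" "\<And>G. G \<in> \<H> \<Longrightarrow> signed_null F \<mu> (G - T)"
    using atomic_support_representative[OF assms(1,2,4)] by blast
  have "S \<in> F" "T \<in> F" using S(1) T(1) assms(3,4) by (auto simp: cu_families_def)
  then have "S \<in> atomic_support F \<mu> \<G>" "T \<in> atomic_support F \<mu> \<H>"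
    using atomic_support_eq_class[OF assms(1-3) S] atomic_support_eq_class[OF assms(1,2,4) T]
      equiv_class_self[OF equiv_ae_eq_rel[OF assms(1,2)]] by auto
  moreover have "ae_subset F \<mu> S T"
    using S(1) T(2) assms(5) by (auto simp: ae_subset_def)
  ultimately show ?thesis unfolding class_subset_def by blast
qed

lemma atomic_support_cu_Sup_countable:
  assumes "sigma_algebra \<Omega> F" "signed_measure F \<mu>"
    and "I \<noteq> {}" "\<And>i. i \<in> I \<Longrightarrow> \<G> i \<in> cu_families F"
  shows "\<exists>J. J \<subseteq> I \<and> J \<noteq> {} \<and> countable J \<and>
    atomic_support F \<mu> (cu_Sup F (\<G> ` I)) = atomic_support F \<mu> (cu_Sup F (\<G> ` J))"
proof -
  have I: "\<G> ` I \<noteq> {}" "\<G> ` I \<subseteq> cu_families F" using assms(3,4) by auto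
  note supI = cu_Sup_least[OF assms(1) I]
  obtain S where S: "S \<in> cu_Sup F (\<G> ` I)"
      "\<And>G. G \<in> cu_Sup F (\<G> ` I) \<Longrightarrow> signed_null F \<mu> (G - S)"
    using atomic_support_representative[OF assms(1,2) supI(1)] by blast
  obtain A :: "nat \<Rightarrow> 'a set" where A: "range A \<subseteq> \<Union>(\<G> ` I)" "S = (\<Union>n. A n)"
    using cu_Sup_countable_union[OF assms(1) I S(1)] by blast
  have "\<forall>n. \<exists>i\<in>I. A n \<in> \<G> i" using A(1) by blast
  then obtain i where i: "\<And>n. i n \<in> I" "\<And>n. A n \<in> \<G> (i n)" by metis
  \<comment> \<open>One index is chosen for each \<open>A n\<close>; as the image of the naturals,
    \<open>?J\<close> is countable and non-empty.\<close>
  let ?J = "range i"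
  have J: "\<G> ` ?J \<noteq> {}" "\<G> ` ?J \<subseteq> cu_families F" using i(1) assms(4) by auto
  note supJ = cu_Sup_least[OF assms(1) J]
  have "range A \<subseteq> cu_Sup F (\<G> ` ?J)" using supJ(2) i(2) by blast
  then have SJ: "S \<in> cu_Sup F (\<G> ` ?J)" using supJ(1) A(2) by (auto simp: cu_families_def)
  \<comment> \<open>\<open>S\<close> dominates the larger supremum, hence also the smaller one, of
    which it is a member. So the same \<open>S\<close> represents both supports.\<close>
  have "cu_Sup F (\<G> ` ?J) \<subseteq> cu_Sup F (\<G> ` I)"
    by (rule supJ(3)[OF supI(1)]) (use supI(2) i(1) in blast)
  then have "atomic_support F \<mu> (cu_Sup F (\<G> ` ?J)) = ae_eq_rel F \<mu> `` {S}"
    using S(2) by (intro atomic_support_eq_class[OF assms(1,2) supJ(1) SJ]) auto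
  then show ?thesis
    using i(1) atomic_support_eq_class[OF assms(1,2) supI(1) S] by (intro exI[of _ ?J]) auto
qed

text \<open>This collapses \<open>class_Union\<close>, an image over all choices of representatives,
  to the class of one particular union.\<close>

lemma equiv_Image_eq:
  assumes "equiv A r" "x \<in> B" "\<And>y. y \<in> B \<Longrightarrow> (x, y) \<in> r"
  shows "r `` B = r `` {x}"
proof
  show "r `` B \<subseteq> r `` {x}"
  proof
    fix z assume "z \<in> r `` B"
    then obtain y where "y \<in> B" "(y, z) \<in> r" by blast
    moreover have "trans r" using assms(1) by (rule equivE)
    ultimately show "z \<in> r `` {x}" using assms(3) by (meson Image_singleton_iff transD)
  qed
  show "r `` {x} \<subseteq> r `` B"
    using assms(2) by auto
qed

lemma atomic_support_cu_Sup_Union: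
  assumes "sigma_algebra \<Omega> F" "signed_measure F \<mu>"
    and "J \<noteq> {}" "countable J" "\<And>i. i \<in> J \<Longrightarrow> \<G> i \<in> cu_families F"
  shows "atomic_support F \<mu> (cu_Sup F (\<G> ` J)) =
    class_Union F \<mu> (\<lambda>i. atomic_support F \<mu> (\<G> i)) J"
proof -
  interpret sigma_algebra \<Omega> F by fact
  note eqv = equiv_ae_eq_rel[OF assms(1,2)]
  have J: "\<G> ` J \<noteq> {}" "\<G> ` J \<subseteq> cu_families F" using assms(3,5) by auto
  note supJ = cu_Sup_least[OF assms(1) J]
  have "\<exists>S. S \<in> \<G> i \<and> (\<forall>G\<in>\<G> i. signed_null F \<mu> (G - S))" if "i \<in> J" for i
    by (rule atomic_support_representative[OF assms(1,2) assms(5)[OF that]]) auto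
  then obtain S where S: "\<And>i. i \<in> J \<Longrightarrow> S i \<in> \<G> i"
      "\<And>i G. i \<in> J \<Longrightarrow> G \<in> \<G> i \<Longrightarrow> signed_null F \<mu> (G - S i)" by metis
  have supp: "atomic_support F \<mu> (\<G> i) = ae_eq_rel F \<mu> `` {S i}" if "i \<in> J" for i
    using S[OF that] by (rule atomic_support_eq_class[OF assms(1,2) assms(5)[OF that]])
  have SF: "S i \<in> F" if "i \<in> J" for i
    using that S(1) assms(5) by (auto simp: cu_families_def)
  \<comment> \<open>The candidate representative: \<open>T\<close> is a member of the supremum since
    \<open>J\<close> is countable and non-empty, and it remains to see that it dominates every
    member.\<close>
  define T where "T = (\<Union>i\<in>J. S i)"
  have TF: "T \<in> F" unfolding T_def using SF assms(4) by (intro countable_UN') auto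
  have TJ: "T \<in> cu_Sup F (\<G> ` J)"
    unfolding T_def
  proof (rule cu_families_UN[OF supJ(1) assms(4,3)])
    show "S i \<in> cu_Sup F (\<G> ` J)" if "i \<in> J" for i
      using supJ(2)[OF imageI[OF that]] S(1)[OF that] by (rule subsetD)
  qed
  \<comment> \<open>By leastness of the supremum it suffices to dominate the members of each
    \<open>\<G> i\<close>, and \<open>S i \<subseteq> T\<close> already does so.\<close>
  have "cu_Sup F (\<G> ` J) \<subseteq> {A \<in> F. ae_subset F \<mu> A T}"
  proof (rule supJ(3)[OF dominated_cu_families[OF assms(1,2) TF]], clarify)
    fix i A assume iA: "i \<in> J" "A \<in> \<G> i"
    then have AF: "A \<in> F" using assms(5) by (auto simp: cu_families_def)
    have "ae_subset F \<mu> A (S i)" using iA S(2) by (simp add: ae_subset_def)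
    moreover have "S i \<subseteq> T" using iA(1) by (auto simp: T_def)
    ultimately show "A \<in> F \<and> ae_subset F \<mu> A T"
      using AF ae_subset_mono[OF assms(1) AF TF] by blast
  qed
  then have "atomic_support F \<mu> (cu_Sup F (\<G> ` J)) = ae_eq_rel F \<mu> `` {T}"
    by (intro atomic_support_eq_class[OF assms(1,2) supJ(1) TJ]) (auto simp: ae_subset_def)
  also have "\<dots> = class_Union F \<mu> (\<lambda>i. atomic_support F \<mu> (\<G> i)) J"
  proof -
    let ?U = "{\<Union>i\<in>J. R i | R. \<forall>i\<in>J. R i \<in> atomic_support F \<mu> (\<G> i)}"
    have "T \<in> ?U"
      unfolding T_def using supp SF equiv_class_self[OF eqv]
      by (intro CollectI exI[of _ S]) simp
    \<comment> \<open>Another choice \<open>R\<close> differs from \<open>S\<close> by a null set at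
      each index. Since \<open>J\<close> is countable, the two unions still agree up to a null
      set.\<close>
    moreover have "(T, B) \<in> ae_eq_rel F \<mu>" if "B \<in> ?U" for B
    proof -
      obtain R where R: "B = (\<Union>i\<in>J. R i)" "\<And>i. i \<in> J \<Longrightarrow> R i \<in> atomic_support F \<mu> (\<G> i)"
        using \<open>B \<in> ?U\<close> by blast
      then have R': "R i \<in> F" "ae_subset F \<mu> (S i) (R i)" "ae_subset F \<mu> (R i) (S i)"
        if "i \<in> J" for i
        using that supp by (auto simp: ae_eq_rel_def)
      have BF: "B \<in> F" unfolding R(1) using R' assms(4) by (intro countable_UN') auto
      have "ae_subset F \<mu> (S i) B" "ae_subset F \<mu> (R i) T" if "i \<in> J" for i
        using that R' SF[OF that] ae_subset_mono[OF assms(1) _ BF, of "S i" \<mu> "R i"]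
          ae_subset_mono[OF assms(1) _ TF, of "R i" \<mu> "S i"]
        by (auto simp: R(1) T_def)
      then have "ae_subset F \<mu> T B" "ae_subset F \<mu> B T"
        using ae_subset_UN[OF assms(1,2,4,3) SF BF] ae_subset_UN[OF assms(1,2,4,3) R'(1) TF]
        by (auto simp: T_def R(1))
      then show ?thesis using TF BF by (simp add: ae_eq_rel_def)
    qed
    ultimately have "ae_eq_rel F \<mu> `` ?U = ae_eq_rel F \<mu> `` {T}"
      by (rule equiv_Image_eq[OF eqv])
    then show ?thesis unfolding class_Union_def ..
  qed
  finally show ?thesis .
qed

theorem proposition7p2:
  fixes \<Omega> :: "'a set" and F :: "'a set set" and \<mu> :: "'a set \<Rightarrow> real"
  assumes "sigma_algebra \<Omega> F" and "signed_measure F \<mu>"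
  shows "(\<forall>\<G>\<in>cu_families F. \<forall>\<H>\<in>cu_families F. \<G> \<subseteq> \<H> \<longrightarrow>
            class_subset F \<mu> (atomic_support F \<mu> \<G>) (atomic_support F \<mu> \<H>)) \<and>
         (\<forall>(I :: 'i set) (\<G> :: 'i \<Rightarrow> 'a set set). I \<noteq> {} \<longrightarrow> (\<forall>i\<in>I. \<G> i \<in> cu_families F) \<longrightarrow>
            (\<exists>J. J \<subseteq> I \<and> J \<noteq> {} \<and> countable J \<and>
               atomic_support F \<mu> (cu_Sup F (\<G> ` I)) = atomic_support F \<mu> (cu_Sup F (\<G> ` J))) \<and>
            (\<forall>J. J \<subseteq> I \<longrightarrow> J \<noteq> {} \<longrightarrow> countable J \<longrightarrow>
               atomic_support F \<mu> (cu_Sup F (\<G> ` J)) =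
               class_Union F \<mu> (\<lambda>i. atomic_support F \<mu> (\<G> i)) J))"
proof (intro conjI ballI allI impI)
  fix \<G> \<H> assume "\<G> \<in> cu_families F" "\<H> \<in> cu_families F" "\<G> \<subseteq> \<H>"
  then show "class_subset F \<mu> (atomic_support F \<mu> \<G>) (atomic_support F \<mu> \<H>)"
    by (rule atomic_support_mono[OF assms])
next
  fix I :: "'i set" and \<G> assume "I \<noteq> {}" "\<forall>i\<in>I. \<G> i \<in> cu_families F"
  then show "\<exists>J. J \<subseteq> I \<and> J \<noteq> {} \<and> countable J \<and>
      atomic_support F \<mu> (cu_Sup F (\<G> ` I)) = atomic_support F \<mu> (cu_Sup F (\<G> ` J))"
    by (intro atomic_support_cu_Sup_countable[OF assms]) simp_all
next
  fix I J :: "'i set" and \<G>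
  assume "\<forall>i\<in>I. \<G> i \<in> cu_families F" "J \<subseteq> I" "J \<noteq> {}" "countable J"
  then show "atomic_support F \<mu> (cu_Sup F (\<G> ` J)) =
      class_Union F \<mu> (\<lambda>i. atomic_support F \<mu> (\<G> i)) J"
    by (intro atomic_support_cu_Sup_Union[OF assms]) auto
qed

end
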